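(* The infinite hexagonal grid $H_\infty$ satisfies $\varrho_{\mathrm{od}}(H_\infty)=1/2$ and $\chi_{\mathrm{so}}(H_\infty)=2$.
   Context: $H_\infty$ is the $3$-regular infinite plane graph formed by the vertices and edges of the tiling of the plane by congruent regular hexagons. $N(v)$ is the open neighborhood of $v$. An odd independent set is an independent set $S$ of vertices such that every vertex $v\notin S$ has either $N(v)\cap S=\varnothing$ or $|N(v)\cap S|$ odd. For an infinite plane graph $G$ with a given planar embedding, the odd independence density is $\varrho_{\mathrm{od}}(G):=\sup_S\limsup_{H_n,\ n\to\infty}|S\cap V(H_n)|/|V(H_n)|$, where $S$ ranges over all odd independent sets of $G$ and $H_n$ ranges over all subgraphs induced by the vertices inside axis-parallel squares of size $n$ in the plane. A strong odd coloring is a proper vertex coloring such that for every vertex $v$, each color used in $N(v)$ appears an odd number of times in $N(v)$; $\chi_{\mathrm{so}}(G)$ is the minimum number of colors in a strong odd coloring of $G$. *)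

theory Defs
  imports "HOL-Analysis.Analysis" "HOL-Library.Extended_Nat" "HOL-Library.Extended_Real"
begin

text \<open>
  A simple graph is a pair of its vertex set and its set of two-element edges.  A plane graph has
  points of \<^typ>\<open>complex\<close> as vertices; the notions below only depend on the positions of the
  vertices and on adjacency, so the arcs representing the edges are not recorded.
\<close>

type_synonym 'a sgraph = "'a set \<times> 'a set set"

abbreviation verts :: "'a sgraph \<Rightarrow> 'a set" where
  "verts G \<equiv> fst G"

abbreviation edges :: "'a sgraph \<Rightarrow> 'a set set" where
  "edges G \<equiv> snd G"

definition nbhd :: "'a sgraph \<Rightarrow> 'a \<Rightarrow> 'a set" where
  "nbhd G v = {u \<in> verts G. {u, v} \<in> edges G}"

definition odd_independent_set :: "'a sgraph \<Rightarrow> 'a set \<Rightarrow> bool" where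
  "odd_independent_set G S \<longleftrightarrow>
     S \<subseteq> verts G \<and>
     (\<forall>u\<in>S. \<forall>v\<in>S. {u, v} \<notin> edges G) \<and>
     (\<forall>v\<in>verts G - S. nbhd G v \<inter> S = {} \<or> odd (card (nbhd G v \<inter> S)))"

definition square_verts :: "complex sgraph \<Rightarrow> complex \<Rightarrow> nat \<Rightarrow> complex set" where
  "square_verts G p n = verts G \<inter> cbox p (p + Complex (real n) (real n))"

text \<open>
  The limit superior is taken over all axis-parallel squares of side \<open>n\<close>, wherever they lie, as
  \<open>n\<close> tends to infinity; hence the supremum over the lower left corner \<open>p\<close> for each \<open>n\<close>.
  The definition is meant for graphs with finitely many vertices in every bounded region.
\<close>

definition odd_independence_density :: "complex sgraph \<Rightarrow> ereal" where
  "odd_independence_density G =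
     (SUP S \<in> {S. odd_independent_set G S}.
        limsup (\<lambda>n. SUP p. ereal (real (card (S \<inter> square_verts G p n)) /
                                  real (card (square_verts G p n)))))"

definition strong_odd_coloring :: "'a sgraph \<Rightarrow> ('a \<Rightarrow> nat) \<Rightarrow> bool" where
  "strong_odd_coloring G f \<longleftrightarrow>
     (\<forall>u\<in>verts G. \<forall>v\<in>verts G. {u, v} \<in> edges G \<longrightarrow> f u \<noteq> f v) \<and>
     (\<forall>v\<in>verts G. \<forall>i\<in>f ` nbhd G v. odd (card {u \<in> nbhd G v. f u = i}))"

text \<open>The value is \<open>\<infinity>\<close> if no strong odd coloring with finitely many colors exists.\<close>

definition strong_odd_chromatic_number :: "'a sgraph \<Rightarrow> enat" where
  "strong_odd_chromatic_number G =
     (INF k \<in> {k. \<exists>f. strong_odd_coloring G f \<and> f ` verts G \<subseteq> {..<k}}. enat k)"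

text \<open>
  The tiling by regular hexagons is determined by the center \<open>c\<close> of one tile and the
  vector \<open>w \<noteq> 0\<close> from that center to one of the corners of the tile.  Reflecting a center in the
  midpoint of a side yields an adjacent center, so two generating translations between centers are
  the sums of consecutive corner vectors, \<open>w + w \<omega>\<close> and \<open>w \<omega> + w \<omega>\<^sup>2\<close> with
  \<open>\<omega> = cis (pi / 3)\<close>.
\<close>

definition hex_center :: "complex \<Rightarrow> complex \<Rightarrow> int \<Rightarrow> int \<Rightarrow> complex" where
  "hex_center c w a b =
     c + of_int a * (w + w * cis (pi / 3)) + of_int b * (w * cis (pi / 3) + w * cis (pi / 3) ^ 2)"

definition hex_corner :: "complex \<Rightarrow> complex \<Rightarrow> int \<Rightarrow> int \<Rightarrow> nat \<Rightarrow> complex" where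
  "hex_corner c w a b k = hex_center c w a b + w * cis (pi / 3) ^ k"

definition hex_grid :: "complex \<Rightarrow> complex \<Rightarrow> complex sgraph" where
  "hex_grid c w =
     ({hex_corner c w a b k | a b k. True},
      {{hex_corner c w a b k, hex_corner c w a b (Suc k)} | a b k. True})"

end

theory Submission
  imports Defs
begin

text \<open>
  The vertices of the grid are the points \<open>c + w (x + y \<omega>)\<close> with integers \<open>x\<close>, \<open>y\<close> such that
  \<open>x - y\<close> is not divisible by 3, where \<open>\<omega> = cis (pi / 3)\<close>.  The residue 1 or 2 of \<open>x - y\<close> modulo 3
  is a proper 2-coloring.  Each vertex has exactly three neighbors, all of the opposite color; as 3 is
  odd, the coloring is a strong odd coloring, and each of its classes is an odd independent set.  One
  color does not suffice because there are edges, so the strong odd chromatic number is 2.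

  The density is at least \<open>1 / 2\<close> (\<open>density_hex_class_ge\<close>): the point reflection in \<open>c\<close> exchanges the
  two classes, so of a square and its image one has at least half of its vertices in the first
  class.

  The density is at most \<open>1 / 2\<close> (\<open>limsup_density_le\<close>) already for independent sets: the edges of
  direction \<open>w\<close> form a perfect matching, and an independent set contains at most one end of each.
  In a square of side \<open>n\<close> only the vertices matched to a vertex outside escape this argument
  (\<open>card_independent_le\<close>).  Comparing areas, their number is \<open>O(n)\<close> (\<open>card_boundary_le\<close>), whereas the
  square contains at least a constant times \<open>n\<^sup>2\<close> vertices for large \<open>n\<close>
  (\<open>card_square_verts_ge\<close>), with constants that do not depend on the position of the square.
\<close>

section \<open>The lattice description of the hexagonal grid\<close>

text \<open>
  The point with integer coordinates \<open>(x, y)\<close> in the Eisenstein lattice with origin \<open>c\<close> and basis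
  \<open>w\<close>, \<open>w \<omega>\<close>, where \<open>\<omega> = cis (pi / 3)\<close>.
\<close>

definition hex_point :: "complex \<Rightarrow> complex \<Rightarrow> int \<Rightarrow> int \<Rightarrow> complex" where
  "hex_point c w x y = c + w * (of_int x + of_int y * cis (pi / 3))"

text \<open>
  The coset of lattice points with \<open>x - y \<equiv> r (mod 3)\<close>, for \<open>r \<in> {0, 1, 2}\<close>.  The coset
  \<open>r = 0\<close> consists of the centers of the tiles; the cosets \<open>r = 1\<close> and \<open>r = 2\<close> turn out to be the two
  classes of the bipartition of the grid.
\<close>

definition hex_class :: "complex \<Rightarrow> complex \<Rightarrow> int \<Rightarrow> complex set" where
  "hex_class c w r = {hex_point c w x y | x y. (x - y) mod 3 = r}"

lemma cis_pi_3_square: "cis (pi / 3) * cis (pi / 3) = cis (pi / 3) - 1"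
  by (simp add: complex_eq_iff cos_60 sin_60 field_simps)

lemma norm_eisenstein:
  "(norm (of_int x + of_int y * cis (pi / 3)))\<^sup>2 = of_int (x\<^sup>2 + x * y + y\<^sup>2)"
proof -
  have "(norm (of_int x + of_int y * cis (pi / 3)))\<^sup>2 =
      (of_int x + of_int y * (1 / 2))\<^sup>2 + (of_int y * (sqrt 3 / 2))\<^sup>2"
    unfolding cmod_power2 by (simp add: cos_60 sin_60)
  also have "\<dots> = (of_int x + of_int y * (1 / 2))\<^sup>2 + (of_int y)\<^sup>2 * (3 / 4)"
    by (simp add: power_mult_distrib power_divide)
  also have "\<dots> = of_int (x\<^sup>2 + x * y + y\<^sup>2)"
    by (simp add: power2_eq_square algebra_simps)
  finally show ?thesis .
qed

lemma norm_eisenstein_ge_1: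
  assumes "x \<noteq> 0 \<or> y \<noteq> 0"
  shows "norm (of_int x + of_int y * cis (pi / 3)) \<ge> 1"
proof -
  have "4 * (x\<^sup>2 + x * y + y\<^sup>2) = (2 * x + y)\<^sup>2 + 3 * y\<^sup>2"
    by (simp add: power2_eq_square algebra_simps)
  moreover have "(2 * x + y)\<^sup>2 + 3 * y\<^sup>2 > 0"
    using assms by (cases "y = 0") (auto intro: add_nonneg_pos)
  ultimately have "x\<^sup>2 + x * y + y\<^sup>2 \<ge> 1"
    by presburger
  then have "1 \<le> (norm (of_int x + of_int y * cis (pi / 3)))\<^sup>2"
    unfolding norm_eisenstein by (metis of_int_1_le_iff)
  then show ?thesis
    using abs_le_square_iff[of 1 "norm (of_int x + of_int y * cis (pi / 3))"] by simp
qed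

lemma dist_hex_point_ge:
  assumes "hex_point c w x y \<noteq> hex_point c w x' y'"
  shows "dist (hex_point c w x y) (hex_point c w x' y') \<ge> norm w"
proof -
  have diff: "hex_point c w x y - hex_point c w x' y' =
      w * (of_int (x - x') + of_int (y - y') * cis (pi / 3))"
    by (simp add: hex_point_def algebra_simps)
  have "x - x' \<noteq> 0 \<or> y - y' \<noteq> 0"
    using assms by auto
  from norm_eisenstein_ge_1[OF this] show ?thesis
    unfolding dist_norm diff norm_mult by (simp add: mult_le_cancel_left1)
qed

lemma hex_point_eq_iff:
  assumes "w \<noteq> 0"
  shows "hex_point c w x y = hex_point c w x' y' \<longleftrightarrow> x = x' \<and> y = y'"
proof
  assume "hex_point c w x y = hex_point c w x' y'"
  then have "w * (of_int (x - x') + of_int (y - y') * cis (pi / 3)) = 0"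
    by (simp add: hex_point_def algebra_simps)
  then have "norm (of_int (x - x') + of_int (y - y') * cis (pi / 3)) = 0"
    using assms by simp
  then show "x = x' \<and> y = y'"
    using norm_eisenstein_ge_1[of "x - x'" "y - y'"] by linarith
qed simp

lemma mod_3_shift:
  fixes i j r s :: int
  assumes "i mod 3 = r" "j = i + s"
  shows "j mod 3 = (r + s) mod 3"
  using mod_add_left_eq[of i 3 s] unfolding assms by simp

lemma hex_point_mem_class_iff:
  assumes "w \<noteq> 0"
  shows "hex_point c w x y \<in> hex_class c w r \<longleftrightarrow> (x - y) mod 3 = r"
  using assms by (auto simp: hex_class_def hex_point_eq_iff)

lemma hex_class_disjoint:
  assumes "w \<noteq> 0"
  shows "hex_class c w 1 \<inter> hex_class c w 2 = {}"
  using assms by (auto simp: hex_class_def hex_point_eq_iff)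

lemma center_offset_mod_3: "((a - b + i) - (a + 2 * b + j)) mod 3 = (i - j) mod (3 :: int)"
proof -
  have "(a - b + i) - (a + 2 * b + j) = (i - j) + 3 * (- b)"
    by simp
  then show ?thesis
    by (simp only: mod_mult_self2)
qed

text \<open>
  The six powers of \<open>\<omega>\<close> have the coordinates \<open>(1, 0)\<close>, \<open>(0, 1)\<close>, \<open>(-1, 1)\<close>, \<open>(-1, 0)\<close>,
  \<open>(0, -1)\<close>, \<open>(1, -1)\<close>; the two lists below are the columns of this table.
\<close>

lemma hex_corner_eq_point:
  "hex_corner c w a b k = hex_point c w (a - b + [1, 0, -1, -1, 0, 1] ! (k mod 6))
     (a + 2 * b + [0, 1, 1, 0, -1, -1] ! (k mod 6))"
proof -
  let ?o = "cis (pi / 3)"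
  have o2: "?o ^ 2 = ?o - 1"
    by (simp only: power2_eq_square cis_pi_3_square)
  have o3: "?o ^ 3 = - 1"
    by (simp add: Complex.DeMoivre)
  have o4: "?o ^ 4 = - ?o" and o5: "?o ^ 5 = 1 - ?o"
    using power_add[of ?o 3 1] power_add[of ?o 3 2] o2 o3 by simp_all
  have o6: "?o ^ 6 = 1"
    using power_add[of ?o 3 3] o3 by simp
  have "?o ^ k = ?o ^ (6 * (k div 6) + k mod 6)"
    by simp
  also have "\<dots> = ?o ^ (k mod 6)"
    by (simp only: power_add power_mult o6 power_one mult_1_left)
  also have "\<dots> = of_int ([1, 0, -1, -1, 0, 1] ! (k mod 6)) +
      of_int ([0, 1, 1, 0, -1, -1] ! (k mod 6)) * ?o"
  proof -
    have "k mod 6 \<in> {0, 1, 2, 3, 4, 5}"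
      by auto
    then show ?thesis
      using o2 o3 o4 o5 by (elim insertE emptyE) simp_all
  qed
  finally show ?thesis
    by (simp add: hex_corner_def hex_center_def hex_point_def o2 algebra_simps cis_pi_3_square)
qed

text \<open>
  Conversely, every lattice point with \<open>x \<equiv> y (mod 3)\<close> is the center of a tile.
\<close>

lemma hex_centers:
  assumes "(x - y) mod 3 = (0 :: int)"
  obtains a b where "x = a - b" "y = a + 2 * b"
proof
  show "x = (y - 2 * ((y - x) div 3)) - (y - x) div 3"
    using assms by presburger
  show "y = (y - 2 * ((y - x) div 3)) + 2 * ((y - x) div 3)"
    by simp
qed

lemma verts_hex_grid: "verts (hex_grid c w) = hex_class c w 1 \<union> hex_class c w 2"
proof (intro equalityI subsetI)
  fix v assume "v \<in> verts (hex_grid c w)"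
  then obtain a b k where v: "v = hex_corner c w a b k"
    by (auto simp: hex_grid_def)
  have "k mod 6 \<in> {0, 1, 2, 3, 4, 5}"
    by auto
  then have "((a - b + [1, 0, -1, -1, 0, 1] ! (k mod 6)) -
      (a + 2 * b + [0, 1, 1, 0, -1, -1] ! (k mod 6))) mod 3 \<in> {1, 2}"
    unfolding center_offset_mod_3 by (elim insertE emptyE) simp_all
  then show "v \<in> hex_class c w 1 \<union> hex_class c w 2"
    unfolding v hex_corner_eq_point hex_class_def by blast
next
  fix v assume "v \<in> hex_class c w 1 \<union> hex_class c w 2"
  then obtain x y where v: "v = hex_point c w x y" and "(x - y) mod 3 = 1 \<or> (x - y) mod 3 = 2"
    by (auto simp: hex_class_def)
  then have "(x - 1 - y) mod 3 = 0 \<or> (x + 1 - y) mod 3 = 0"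
    by presburger
  then have "\<exists>a b k. v = hex_corner c w a b k"
  proof
    assume "(x - 1 - y) mod 3 = 0"
    then obtain a b where "x - 1 = a - b" "y = a + 2 * b"
      by (rule hex_centers)
    then have "x = a - b + 1" "y = a + 2 * b"
      by simp_all
    then have "v = hex_corner c w a b 0"
      unfolding v hex_corner_eq_point by simp
    then show ?thesis
      by blast
  next
    assume "(x + 1 - y) mod 3 = 0"
    then obtain a b where "x + 1 = a - b" "y = a + 2 * b"
      by (rule hex_centers)
    then have "x = a - b - 1" "y = a + 2 * b"
      by simp_all
    then have "v = hex_corner c w a b 3"
      unfolding v hex_corner_eq_point by simp
    then show ?thesis
      by blast
  qed
  then show "v \<in> verts (hex_grid c w)"
    by (auto simp: hex_grid_def)
qed

text \<open>
  Written from their end in class 1, the edges have the three directions \<open>w\<close>, \<open>w \<omega>\<^sup>2\<close>,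
  \<open>w \<omega>\<^sup>4\<close>.
\<close>

lemma edges_hex_grid:
  "edges (hex_grid c w) =
     {{hex_point c w x y, hex_point c w (x + d) (y + e)} | x y d e.
        (x - y) mod 3 = 1 \<and> (d, e) \<in> {(1, 0), (-1, 1), (0, -1)}}" (is "_ = ?E")
proof (intro equalityI subsetI)
  fix E assume "E \<in> edges (hex_grid c w)"
  then obtain a b k where E: "E = {hex_corner c w a b k, hex_corner c w a b (Suc k)}"
    by (auto simp: hex_grid_def)
  have mem: "\<And>x y d e. E = {hex_point c w x y, hex_point c w (x + d) (y + e)} \<Longrightarrow>
      (x - y) mod 3 = 1 \<Longrightarrow> (d, e) \<in> {(1, 0), (-1, 1), (0, -1)} \<Longrightarrow> E \<in> ?E"
    by blast
  have m: "(a - b + 1 - (a + 2 * b)) mod 3 = 1"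
    "(a - b - 1 - (a + 2 * b + 1)) mod 3 = 1" "(a - b - (a + 2 * b - 1)) mod 3 = 1"
    using center_offset_mod_3[of a b 1 0] center_offset_mod_3[of a b "-1" 1]
      center_offset_mod_3[of a b 0 "-1"] by simp_all
  have k: "k mod 6 \<in> {0, 1, 2, 3, 4, 5}"
    by auto
  consider "k mod 6 = 0" "Suc k mod 6 = 1" | "k mod 6 = 1" "Suc k mod 6 = 2"
    | "k mod 6 = 2" "Suc k mod 6 = 3" | "k mod 6 = 3" "Suc k mod 6 = 4"
    | "k mod 6 = 4" "Suc k mod 6 = 5" | "k mod 6 = 5" "Suc k mod 6 = 0"
    using k by (auto simp: mod_Suc)
  then show "E \<in> ?E"
  proof cases
    case 1
    have "E = {hex_point c w (a - b + 1) (a + 2 * b), hex_point c w (a - b + 1 + (- 1)) (a + 2 * b + 1)}"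
      by (simp add: E hex_corner_eq_point 1 doubleton_eq_iff)
    then show ?thesis
      by (rule mem[OF _ m(1)]) simp
  next
    case 2
    have "E = {hex_point c w (a - b - 1) (a + 2 * b + 1), hex_point c w (a - b - 1 + 1) (a + 2 * b + 1 + 0)}"
      by (simp add: E hex_corner_eq_point 2 doubleton_eq_iff)
    then show ?thesis
      by (rule mem[OF _ m(2)]) simp
  next
    case 3
    have "E = {hex_point c w (a - b - 1) (a + 2 * b + 1), hex_point c w (a - b - 1 + 0) (a + 2 * b + 1 + (- 1))}"
      by (simp add: E hex_corner_eq_point 3 doubleton_eq_iff)
    then show ?thesis
      by (rule mem[OF _ m(2)]) simp
  next
    case 4
    have "E = {hex_point c w (a - b) (a + 2 * b - 1), hex_point c w (a - b + (- 1)) (a + 2 * b - 1 + 1)}"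
      by (simp add: E hex_corner_eq_point 4 doubleton_eq_iff)
    then show ?thesis
      by (rule mem[OF _ m(3)]) simp
  next
    case 5
    have "E = {hex_point c w (a - b) (a + 2 * b - 1), hex_point c w (a - b + 1) (a + 2 * b - 1 + 0)}"
      by (simp add: E hex_corner_eq_point 5 doubleton_eq_iff)
    then show ?thesis
      by (rule mem[OF _ m(3)]) simp
  next
    case 6
    have "E = {hex_point c w (a - b + 1) (a + 2 * b), hex_point c w (a - b + 1 + 0) (a + 2 * b + (- 1))}"
      by (simp add: E hex_corner_eq_point 6 doubleton_eq_iff)
    then show ?thesis
      by (rule mem[OF _ m(1)]) simp
  qed
next
  fix E assume "E \<in> ?E"
  then obtain x y d e where E: "E = {hex_point c w x y, hex_point c w (x + d) (y + e)}"
    and m: "(x - y) mod 3 = 1" and de: "(d, e) \<in> {(1, 0), (-1, 1), (0, -1)}"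
    by blast
  have edge: "\<And>a b k. E = {hex_corner c w a b k, hex_corner c w a b (Suc k)} \<Longrightarrow> E \<in> edges (hex_grid c w)"
    by (auto simp: hex_grid_def)
  \<comment> \<open>The lattice point to the left of \<open>(x, y)\<close> is the center of a tile with corner \<open>(x, y)\<close>; this
    tile has two of the three edges at \<open>(x, y)\<close>, an adjacent tile has the third.\<close>
  obtain a b where ab: "x - 1 = a - b" "y = a + 2 * b"
    using m by (elim hex_centers[of "x - 1" y, rotated]) presburger
  have x: "x = a - b + 1"
    using ab by simp
  from de consider "d = -1" "e = 1" | "d = 0" "e = -1" | "d = 1" "e = 0"
    by auto
  then show "E \<in> edges (hex_grid c w)"
  proof cases
    case 1
    then show ?thesis
      by (intro edge[of a b 0]) (simp add: E hex_corner_eq_point x ab)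
  next
    case 2
    then show ?thesis
      by (intro edge[of a b 5]) (simp add: E hex_corner_eq_point x ab insert_commute)
  next
    case 3
    then show ?thesis
      by (intro edge[of "a + 1" b 4]) (simp add: E hex_corner_eq_point x ab algebra_simps)
  qed
qed

section \<open>Bipartition, neighborhoods and the strong odd coloring\<close>

lemma edge_hex_point_iff:
  assumes "w \<noteq> 0" "(x - y) mod 3 = 1"
  shows "{hex_point c w x' y', hex_point c w x y} \<in> edges (hex_grid c w) \<longleftrightarrow>
    (x' - x, y' - y) \<in> {(1, 0), (-1, 1), (0, -1)}"
proof
  assume "{hex_point c w x' y', hex_point c w x y} \<in> edges (hex_grid c w)"
  then obtain a b d e where eq: "{hex_point c w x' y', hex_point c w x y} =
      {hex_point c w a b, hex_point c w (a + d) (b + e)}"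
    and ab: "(a - b) mod 3 = 1" and de: "(d, e) \<in> {(1, 0), (-1, 1), (0, -1)}"
    unfolding edges_hex_grid by blast
  have "(a + d - (b + e)) mod 3 \<noteq> 1"
    using mod_3_shift[OF ab, of "a + d - (b + e)" "d - e"] de by auto
  then have "x = a \<and> y = b \<and> x' = a + d \<and> y' = b + e"
    using eq assms by (auto simp: doubleton_eq_iff hex_point_eq_iff)
  then show "(x' - x, y' - y) \<in> {(1, 0), (-1, 1), (0, -1)}"
    using de by simp
next
  assume "(x' - x, y' - y) \<in> {(1, 0), (-1, 1), (0, -1)}"
  moreover have "{hex_point c w x' y', hex_point c w x y} =
      {hex_point c w x y, hex_point c w (x + (x' - x)) (y + (y' - y))}"
    by auto
  ultimately show "{hex_point c w x' y', hex_point c w x y} \<in> edges (hex_grid c w)"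
    unfolding edges_hex_grid using assms(2) by blast
qed

lemma edge_classes:
  assumes "w \<noteq> 0" "{u, v} \<in> edges (hex_grid c w)"
  shows "(u \<in> hex_class c w 1 \<and> v \<in> hex_class c w 2) \<or> (u \<in> hex_class c w 2 \<and> v \<in> hex_class c w 1)"
proof -
  from assms(2) obtain x y d e where eq: "{u, v} = {hex_point c w x y, hex_point c w (x + d) (y + e)}"
    and xy: "(x - y) mod 3 = 1" and de: "(d, e) \<in> {(1, 0), (-1, 1), (0, -1)}"
    unfolding edges_hex_grid by blast
  have "(x + d - (y + e)) mod 3 = 2"
    using mod_3_shift[OF xy, of "x + d - (y + e)" "d - e"] de by auto
  then show ?thesis
    using eq xy assms(1) by (auto simp: doubleton_eq_iff hex_point_mem_class_iff)
qed

lemma nbhd_class_1: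
  assumes "w \<noteq> 0" "(x - y) mod 3 = 1"
  shows "nbhd (hex_grid c w) (hex_point c w x y) =
    {hex_point c w (x + 1) y, hex_point c w (x - 1) (y + 1), hex_point c w x (y - 1)}"
proof (intro equalityI subsetI)
  fix u assume u: "u \<in> nbhd (hex_grid c w) (hex_point c w x y)"
  then obtain x' y' where "u = hex_point c w x' y'"
    by (auto simp: nbhd_def verts_hex_grid hex_class_def)
  moreover from this u have "(x' - x, y' - y) \<in> {(1, 0), (-1, 1), (0, -1)}"
    by (simp add: nbhd_def edge_hex_point_iff[OF assms])
  then have "x' = x + 1 \<and> y' = y \<or> x' = x - 1 \<and> y' = y + 1 \<or> x' = x \<and> y' = y - 1"
    by auto
  ultimately show "u \<in> {hex_point c w (x + 1) y, hex_point c w (x - 1) (y + 1), hex_point c w x (y - 1)}"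
    by blast
next
  fix u assume "u \<in> {hex_point c w (x + 1) y, hex_point c w (x - 1) (y + 1), hex_point c w x (y - 1)}"
  then have e: "{u, hex_point c w x y} \<in> edges (hex_grid c w)"
    using edge_hex_point_iff[OF assms] by auto
  with edge_classes[OF assms(1) e] show "u \<in> nbhd (hex_grid c w) (hex_point c w x y)"
    by (auto simp: nbhd_def verts_hex_grid)
qed

lemma nbhd_class_2:
  assumes "w \<noteq> 0" "(x - y) mod 3 = 2"
  shows "nbhd (hex_grid c w) (hex_point c w x y) =
    {hex_point c w (x - 1) y, hex_point c w (x + 1) (y - 1), hex_point c w x (y + 1)}"
proof (intro equalityI subsetI)
  fix u assume u: "u \<in> nbhd (hex_grid c w) (hex_point c w x y)"
  then have e: "{u, hex_point c w x y} \<in> edges (hex_grid c w)"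
    by (simp add: nbhd_def)
  from edge_classes[OF assms(1) e] obtain x' y' where u': "u = hex_point c w x' y'" "(x' - y') mod 3 = 1"
    using assms by (auto simp: hex_point_mem_class_iff) (auto simp: hex_class_def)
  have "(x - x', y - y') \<in> {(1, 0), (-1, 1), (0, -1)}"
    using edge_hex_point_iff[OF assms(1) u'(2)] e by (simp add: u' insert_commute)
  then have "x' = x - 1 \<and> y' = y \<or> x' = x + 1 \<and> y' = y - 1 \<or> x' = x \<and> y' = y + 1"
    by auto
  then show "u \<in> {hex_point c w (x - 1) y, hex_point c w (x + 1) (y - 1), hex_point c w x (y + 1)}"
    using u' by blast
next
  fix u assume "u \<in> {hex_point c w (x - 1) y, hex_point c w (x + 1) (y - 1), hex_point c w x (y + 1)}"
  then obtain x' y' where u: "u = hex_point c w x' y'" "(x - x', y - y') \<in> {(1, 0), (-1, 1), (0, -1)}"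
    by force
  then have "(x' - y') mod 3 = 1"
    using mod_3_shift[OF assms(2), of "x' - y'" "(y - y') - (x - x')"] by auto
  from edge_hex_point_iff[OF assms(1) this] u have e: "{hex_point c w x y, u} \<in> edges (hex_grid c w)"
    by blast
  with edge_classes[OF assms(1) e] show "u \<in> nbhd (hex_grid c w) (hex_point c w x y)"
    by (auto simp: nbhd_def verts_hex_grid insert_commute)
qed

lemma card_nbhd_hex_grid:
  assumes "w \<noteq> 0" "v \<in> verts (hex_grid c w)"
  shows "card (nbhd (hex_grid c w) v) = 3"
proof -
  from assms(2) consider x y where "v = hex_point c w x y" "(x - y) mod 3 = 1"
    | x y where "v = hex_point c w x y" "(x - y) mod 3 = 2"
    by (auto simp: verts_hex_grid hex_class_def)
  then show ?thesis
    by cases (simp_all add: nbhd_class_1 nbhd_class_2 hex_point_eq_iff assms(1))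
qed

lemma nbhd_subset_class_2:
  assumes "w \<noteq> 0" "v \<in> hex_class c w 1"
  shows "nbhd (hex_grid c w) v \<subseteq> hex_class c w 2"
  using assms edge_classes[OF assms(1)] hex_class_disjoint[OF assms(1)] by (fastforce simp: nbhd_def)

lemma nbhd_subset_class_1:
  assumes "w \<noteq> 0" "v \<in> hex_class c w 2"
  shows "nbhd (hex_grid c w) v \<subseteq> hex_class c w 1"
  using assms edge_classes[OF assms(1)] hex_class_disjoint[OF assms(1)] by (fastforce simp: nbhd_def)

lemma odd_independent_hex_class:
  assumes "w \<noteq> 0"
  shows "odd_independent_set (hex_grid c w) (hex_class c w 1)"
  unfolding odd_independent_set_def
proof (intro conjI ballI)
  show "hex_class c w 1 \<subseteq> verts (hex_grid c w)"
    by (simp add: verts_hex_grid)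
next
  fix u v assume "u \<in> hex_class c w 1" "v \<in> hex_class c w 1"
  then show "{u, v} \<notin> edges (hex_grid c w)"
    using edge_classes[OF assms] hex_class_disjoint[OF assms] by blast
next
  fix v assume "v \<in> verts (hex_grid c w) - hex_class c w 1"
  then have v: "v \<in> verts (hex_grid c w)" and "v \<in> hex_class c w 2"
    by (auto simp: verts_hex_grid)
  then have "nbhd (hex_grid c w) v \<inter> hex_class c w 1 = nbhd (hex_grid c w) v"
    using nbhd_subset_class_1[OF assms] by blast
  then show "nbhd (hex_grid c w) v \<inter> hex_class c w 1 = {} \<or>
      odd (card (nbhd (hex_grid c w) v \<inter> hex_class c w 1))"
    using card_nbhd_hex_grid[OF assms v] by simp
qed

lemma strong_odd_coloring_hex_grid:
  assumes "w \<noteq> 0"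
  shows "strong_odd_coloring (hex_grid c w) (\<lambda>v. if v \<in> hex_class c w 1 then 0 else 1)"
    (is "strong_odd_coloring _ ?f")
  unfolding strong_odd_coloring_def
proof (intro conjI ballI impI)
  fix u v assume "{u, v} \<in> edges (hex_grid c w)"
  then show "?f u \<noteq> ?f v"
    using edge_classes[OF assms, of u v c] hex_class_disjoint[OF assms, of c] by auto
next
  fix v i assume v: "v \<in> verts (hex_grid c w)" and i: "i \<in> ?f ` nbhd (hex_grid c w) v"
  have "\<forall>u\<in>nbhd (hex_grid c w) v. \<forall>u'\<in>nbhd (hex_grid c w) v. ?f u = ?f u'"
    using nbhd_subset_class_2[OF assms, of v] nbhd_subset_class_1[OF assms, of v] v hex_class_disjoint[OF assms]
    by (fastforce simp: verts_hex_grid)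
  then have "{u \<in> nbhd (hex_grid c w) v. ?f u = i} = nbhd (hex_grid c w) v"
    using i by blast
  then show "odd (card {u \<in> nbhd (hex_grid c w) v. ?f u = i})"
    using card_nbhd_hex_grid[OF assms v] by simp
qed

lemma strong_odd_chromatic_number_hex_grid:
  assumes "w \<noteq> 0"
  shows "strong_odd_chromatic_number (hex_grid c w) = 2"
proof (rule antisym)
  have "strong_odd_chromatic_number (hex_grid c w) \<le> enat 2"
    unfolding strong_odd_chromatic_number_def
    using strong_odd_coloring_hex_grid[OF assms, of c] by (intro INF_lower) fastforce
  then show "strong_odd_chromatic_number (hex_grid c w) \<le> 2"
    by (simp add: numeral_eq_enat)
next
  have "enat 2 \<le> strong_odd_chromatic_number (hex_grid c w)"
    unfolding strong_odd_chromatic_number_def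
  proof (rule INF_greatest)
    fix k assume "k \<in> {k. \<exists>f. strong_odd_coloring (hex_grid c w) f \<and> f ` verts (hex_grid c w) \<subseteq> {..<k}}"
    then obtain f where f: "strong_odd_coloring (hex_grid c w) f" "f ` verts (hex_grid c w) \<subseteq> {..<k}"
      by blast
    \<comment> \<open>The ends of a single edge already need two colors.\<close>
    let ?u = "hex_point c w 2 0" and ?v = "hex_point c w 1 0"
    have e: "{?u, ?v} \<in> edges (hex_grid c w)"
      using assms by (simp add: edge_hex_point_iff)
    have uv: "?u \<in> verts (hex_grid c w)" "?v \<in> verts (hex_grid c w)"
      by (simp_all add: verts_hex_grid hex_point_mem_class_iff assms)
    then have "f ?u \<noteq> f ?v"
      using f(1) e unfolding strong_odd_coloring_def by blast
    moreover have "f ?u < k" "f ?v < k"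
      using f(2) uv by auto
    ultimately show "enat 2 \<le> enat k"
      by simp
  qed
  then show "2 \<le> strong_odd_chromatic_number (hex_grid c w)"
    by (simp add: numeral_eq_enat)
qed

section \<open>A perfect matching\<close>

text \<open>
  The edges of direction \<open>w\<close> form a perfect matching; the function maps a vertex to the other end of
  its matching edge.  Its values outside the vertex set are irrelevant.
\<close>

definition partner :: "complex \<Rightarrow> complex \<Rightarrow> complex \<Rightarrow> complex" where
  "partner c w v = (if v \<in> hex_class c w 1 then v + w else v - w)"

lemma partner_class_1:
  assumes "v \<in> hex_class c w 1"
  shows "v + w \<in> hex_class c w 2"
proof -
  from assms obtain x y where v: "v = hex_point c w x y" and "(x - y) mod 3 = 1"
    by (auto simp: hex_class_def)
  then have "(x + 1 - y) mod 3 = 2"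
    using mod_3_shift[of "x - y" 1 "x + 1 - y" 1] by simp
  moreover have "v + w = hex_point c w (x + 1) y"
    by (simp add: v hex_point_def algebra_simps)
  ultimately show ?thesis
    unfolding hex_class_def by blast
qed

lemma partner_class_2:
  assumes "v \<in> hex_class c w 2"
  shows "v - w \<in> hex_class c w 1"
proof -
  from assms obtain x y where v: "v = hex_point c w x y" and "(x - y) mod 3 = 2"
    by (auto simp: hex_class_def)
  then have "(x - 1 - y) mod 3 = 1"
    using mod_3_shift[of "x - y" 2 "x - 1 - y" "-1"] by simp
  moreover have "v - w = hex_point c w (x - 1) y"
    by (simp add: v hex_point_def algebra_simps)
  ultimately show ?thesis
    unfolding hex_class_def by blast
qed

lemma partner_verts:
  assumes "v \<in> verts (hex_grid c w)"
  shows "partner c w v \<in> verts (hex_grid c w)"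
  using assms partner_class_1 partner_class_2 by (auto simp: partner_def verts_hex_grid)

lemma partner_partner:
  assumes "w \<noteq> 0" "v \<in> verts (hex_grid c w)"
  shows "partner c w (partner c w v) = v"
  using assms(2) partner_class_1[of v c w] partner_class_2[of v c w] hex_class_disjoint[OF assms(1), of c]
  by (auto simp: partner_def verts_hex_grid)

lemma dist_partner: "dist v (partner c w v) = norm w"
  by (simp add: partner_def dist_norm)

lemma partner_edge:
  assumes "w \<noteq> 0" "v \<in> verts (hex_grid c w)"
  shows "{v, partner c w v} \<in> edges (hex_grid c w)"
proof -
  have *: "{u, u + w} \<in> edges (hex_grid c w)" if u: "u \<in> hex_class c w 1" for u
  proof -
    from u obtain x y where xy: "u = hex_point c w x y" "(x - y) mod 3 = 1"
      by (auto simp: hex_class_def)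
    have "u + w = hex_point c w (x + 1) y"
      by (simp add: xy hex_point_def algebra_simps)
    then show ?thesis
      using edge_hex_point_iff[OF assms(1) xy(2), of c "x + 1" y] by (simp add: xy insert_commute)
  qed
  show ?thesis
    using assms(2) *[of v] *[of "v - w"] partner_class_2[of v c w]
    by (auto simp: partner_def verts_hex_grid insert_commute)
qed

section \<open>Counting the vertices in a square by areas\<close>

text \<open>
  The disks of radius \<open>r\<close> about points of mutual distance at least \<open>2 r\<close> are disjoint, so a region
  containing all of them bounds the number of points.
\<close>

lemma card_separated_le:
  fixes P :: "complex set"
  assumes fin: "finite P" and r: "r > 0"
    and sep: "\<And>u v. u \<in> P \<Longrightarrow> v \<in> P \<Longrightarrow> u \<noteq> v \<Longrightarrow> dist u v \<ge> 2 * r"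
    and X: "X \<in> fmeasurable lborel" and sub: "\<And>v. v \<in> P \<Longrightarrow> ball v r \<subseteq> X"
  shows "real (card P) * (pi * r\<^sup>2) \<le> measure lborel X"
proof -
  have "disjoint_family_on (\<lambda>v. ball v r) P"
  proof (unfold disjoint_family_on_def, intro ballI impI)
    fix u v assume "u \<in> P" "v \<in> P" "u \<noteq> v"
    then have "r + r \<le> dist u v"
      using sep[of u v] by auto
    then show "ball u r \<inter> ball v r = {}"
      by (rule disjoint_ballI)
  qed
  moreover have "emeasure lborel (ball v r) \<noteq> \<infinity>" for v :: complex
    using emeasure_lborel_ball_finite[of v r] by auto
  ultimately have "measure lborel (\<Union>v\<in>P. ball v r) = (\<Sum>v\<in>P. measure lborel (ball v r))"
    using fin by (intro measure_finite_Union) auto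
  also have "\<dots> = real (card P) * (pi * r\<^sup>2)"
    using r by (simp add: content_ball unit_ball_vol_2)
  finally have "real (card P) * (pi * r\<^sup>2) = measure lborel (\<Union>v\<in>P. ball v r)"
    by simp
  also have "\<dots> \<le> measure lborel X"
    using fin sub X by (intro measure_mono_fmeasurable) (auto intro!: borel_open)
  finally show ?thesis .
qed

lemma finite_separated:
  fixes P :: "complex set"
  assumes r: "r > 0"
    and sep: "\<And>u v. u \<in> P \<Longrightarrow> v \<in> P \<Longrightarrow> u \<noteq> v \<Longrightarrow> dist u v \<ge> 2 * r"
    and X: "X \<in> fmeasurable lborel" and sub: "\<And>v. v \<in> P \<Longrightarrow> ball v r \<subseteq> X"
  shows "finite P"
proof (rule ccontr)
  assume "infinite P"
  obtain m :: nat where m: "measure lborel X / (pi * r\<^sup>2) < real m"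
    using reals_Archimedean2 by blast
  obtain F where F: "F \<subseteq> P" "finite F" "card F = m"
    using infinite_arbitrarily_large[OF \<open>infinite P\<close>] by blast
  have "real (card F) * (pi * r\<^sup>2) \<le> measure lborel X"
    by (rule card_separated_le[OF F(2) r sep X sub]) (use F(1) in blast)+
  moreover have "pi * r\<^sup>2 > 0"
    using r by simp
  ultimately show False
    using m F(3) by (simp add: field_simps)
qed

lemma area_cbox_square:
  assumes "a \<ge> 0"
  shows "measure lborel (cbox p (p + Complex a a)) = a\<^sup>2"
  using assms by (simp add: measure_lborel_cbox_eq Basis_complex_def power2_eq_square)

lemma area_box_square:
  assumes "a \<ge> 0"
  shows "measure lborel (box p (p + Complex a a)) = a\<^sup>2"
  using assms by (simp add: measure_lborel_box_eq Basis_complex_def power2_eq_square)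

lemma dist_le_imp_coords:
  assumes "dist z v \<le> r"
  shows "Re v - r \<le> Re z \<and> Re z \<le> Re v + r \<and> Im v - r \<le> Im z \<and> Im z \<le> Im v + r"
  using assms abs_Re_le_cmod[of "z - v"] abs_Im_le_cmod[of "z - v"] unfolding dist_norm by auto

lemma dist_verts_ge:
  assumes "u \<in> verts (hex_grid c w)" "v \<in> verts (hex_grid c w)" "u \<noteq> v"
  shows "dist u v \<ge> norm w"
  using assms dist_hex_point_ge unfolding verts_hex_grid hex_class_def by blast

lemma finite_square_verts:
  assumes "w \<noteq> 0"
  shows "finite (square_verts (hex_grid c w) p n)"
proof (rule finite_separated)
  let ?s = "norm w"
  let ?X = "cbox (p - Complex ?s ?s) (p + Complex (n + ?s) (n + ?s))"
  show "norm w / 2 > 0"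
    using assms by simp
  show "?X \<in> fmeasurable lborel"
    by (rule fmeasurable_cbox)
  show "ball v (?s / 2) \<subseteq> ?X" if v: "v \<in> square_verts (hex_grid c w) p n" for v
  proof
    fix z assume "z \<in> ball v (?s / 2)"
    then have "dist z v \<le> ?s"
      using norm_ge_zero[of w] unfolding mem_ball dist_commute[of v] by linarith
    from dist_le_imp_coords[OF this] show "z \<in> ?X"
      using v by (auto simp: square_verts_def in_cbox_complex_iff)
  qed
  show "dist u v \<ge> 2 * (norm w / 2)"
    if "u \<in> square_verts (hex_grid c w) p n" "v \<in> square_verts (hex_grid c w) p n" "u \<noteq> v" for u v
    using that by (auto simp: square_verts_def intro: dist_verts_ge)
qed

text \<open>
  Rounding the two lattice coordinates of a point down gives a lattice point; if that is a center,
  its right neighbor in the lattice is a vertex.  This yields the (generous) bound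
  \<open>(2 + 1) * norm w\<close>.
\<close>

lemma complex_near_vert:
  assumes "w \<noteq> 0"
  obtains v where "v \<in> verts (hex_grid c w)" "dist z v \<le> 3 * norm w"
proof -
  define q where "q = (z - c) / w"
  define s where "s = Im q / sin (pi / 3)"
  define t where "t = Re q - s / 2"
  have "q = of_real t + of_real s * cis (pi / 3)"
    by (simp add: complex_eq_iff t_def s_def cos_60 sin_60)
  then have z: "z = c + w * (of_real t + of_real s * cis (pi / 3))"
    using assms by (simp add: q_def field_simps)
  obtain x where x: "(x - \<lfloor>s\<rfloor>) mod 3 \<in> {1, 2}" "x = \<lfloor>t\<rfloor> \<or> x = \<lfloor>t\<rfloor> + 1"
  proof (cases "(\<lfloor>t\<rfloor> - \<lfloor>s\<rfloor>) mod 3 = 0")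
    case True
    then have "(\<lfloor>t\<rfloor> + 1 - \<lfloor>s\<rfloor>) mod 3 = 1"
      using mod_3_shift[of "\<lfloor>t\<rfloor> - \<lfloor>s\<rfloor>" 0 "\<lfloor>t\<rfloor> + 1 - \<lfloor>s\<rfloor>" 1] by simp
    then show ?thesis
      by (intro that[of "\<lfloor>t\<rfloor> + 1"]) auto
  next
    case False
    then have "(\<lfloor>t\<rfloor> - \<lfloor>s\<rfloor>) mod 3 = 1 \<or> (\<lfloor>t\<rfloor> - \<lfloor>s\<rfloor>) mod 3 = 2"
      by presburger
    then show ?thesis
      by (intro that[of "\<lfloor>t\<rfloor>"]) auto
  qed
  show thesis
  proof
    show "hex_point c w x \<lfloor>s\<rfloor> \<in> verts (hex_grid c w)"
      using x(1) assms by (simp add: verts_hex_grid hex_point_mem_class_iff)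
    have "z - hex_point c w x \<lfloor>s\<rfloor> = w * (of_real (t - of_int x) + of_real (s - of_int \<lfloor>s\<rfloor>) * cis (pi / 3))"
      by (simp add: z hex_point_def algebra_simps)
    then have "dist z (hex_point c w x \<lfloor>s\<rfloor>) =
        norm w * norm (of_real (t - of_int x) + of_real (s - of_int \<lfloor>s\<rfloor>) * cis (pi / 3))"
      by (simp only: dist_norm norm_mult)
    also have "norm (of_real (t - of_int x) + of_real (s - of_int \<lfloor>s\<rfloor>) * cis (pi / 3)) \<le>
        \<bar>t - of_int x\<bar> + \<bar>s - of_int \<lfloor>s\<rfloor>\<bar>"
      by (rule norm_triangle_le) (simp add: norm_mult del: of_real_diff)
    also have "\<dots> \<le> 3"
      using x(2) by (elim disjE; simp; linarith)
    finally show "dist z (hex_point c w x \<lfloor>s\<rfloor>) \<le> 3 * norm w"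
      by (simp add: mult_left_mono)
  qed
qed

text \<open>
  The disks of radius \<open>3 * norm w\<close> about the vertices in a square cover the smaller concentric
  square whose sides lie at distance \<open>3 * norm w\<close> from those of the given one.
\<close>

lemma card_square_verts_ge:
  assumes "w \<noteq> 0" "real n \<ge> 6 * norm w"
  shows "(real n - 6 * norm w)\<^sup>2 \<le> real (card (square_verts (hex_grid c w) p n)) * (9 * pi * (norm w)\<^sup>2)"
proof -
  let ?Q = "square_verts (hex_grid c w) p n" and ?s = "norm w"
  let ?p = "p + Complex (3 * ?s) (3 * ?s)" and ?a = "real n - 6 * ?s"
  have fin: "finite ?Q"
    by (rule finite_square_verts[OF assms(1)])
  have sub: "cbox ?p (?p + Complex ?a ?a) \<subseteq> (\<Union>v\<in>?Q. cball v (3 * ?s))"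
  proof
    fix z assume z: "z \<in> cbox ?p (?p + Complex ?a ?a)"
    obtain v where v: "v \<in> verts (hex_grid c w)" "dist z v \<le> 3 * ?s"
      using complex_near_vert[OF assms(1)] .
    from dist_le_imp_coords[OF v(2)] have "v \<in> ?Q"
      using z v(1) by (auto simp: square_verts_def in_cbox_complex_iff)
    then show "z \<in> (\<Union>v\<in>?Q. cball v (3 * ?s))"
      using v(2) by (auto simp: dist_commute)
  qed
  have "?a\<^sup>2 = measure lborel (cbox ?p (?p + Complex ?a ?a))"
    using assms(2) by (simp add: area_cbox_square)
  also have "\<dots> \<le> measure lborel (\<Union>v\<in>?Q. cball v (3 * ?s))"
    using fin sub by (intro measure_mono_fmeasurable fmeasurable.finite_UN) (auto intro!: fmeasurableI emeasure_lborel_cball_finite[unfolded infinity_ennreal_def])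
  also have "\<dots> \<le> (\<Sum>v\<in>?Q. measure lborel (cball v (3 * ?s)))"
    using fin by (intro measure_UNION_le) auto
  also have "\<dots> = real (card ?Q) * (9 * pi * ?s\<^sup>2)"
    by (simp add: content_cball unit_ball_vol_2 power_mult_distrib)
  finally show ?thesis .
qed

text \<open>
  A vertex of the square whose matching edge leaves the square is close to the boundary, so its disk
  of radius \<open>norm w / 2\<close> lies in a frame whose area is linear in \<open>n\<close>.
\<close>

lemma card_boundary_le:
  assumes "w \<noteq> 0" "real n \<ge> 4 * norm w"
  shows "real (card {v \<in> square_verts (hex_grid c w) p n. partner c w v \<notin> square_verts (hex_grid c w) p n})
           * (pi * (norm w)\<^sup>2) \<le> 48 * norm w * real n" (is "real (card ?D) * _ \<le> _")
proof -
  let ?Q = "square_verts (hex_grid c w) p n" and ?s = "norm w"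
  let ?p = "p - Complex ?s ?s" and ?a = "real n + 2 * ?s"
  let ?q = "p + Complex (2 * ?s) (2 * ?s)" and ?b = "real n - 4 * ?s"
  \<comment> \<open>A point of such a disk has distance at most \<open>3 / 2 * norm w\<close> from the partner, which lies outside
    the square; so it is not in the inner square, which is inset by \<open>2 * norm w\<close>.\<close>
  let ?O = "cbox ?p (?p + Complex ?a ?a)" and ?I = "box ?q (?q + Complex ?b ?b)"
  have s: "?s > 0"
    using assms(1) by simp
  have "real (card ?D) * (pi * (?s / 2)\<^sup>2) \<le> measure lborel (?O - ?I)"
  proof (rule card_separated_le)
    show "finite ?D"
      using finite_square_verts[OF assms(1)] by simp
    show "?O - ?I \<in> fmeasurable lborel"
      by (intro fmeasurable_Diff fmeasurable_cbox) auto
    show "?s / 2 > 0"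
      using s by simp
    show "dist u v \<ge> 2 * (?s / 2)" if "u \<in> ?D" "v \<in> ?D" "u \<noteq> v" for u v
      using that by (auto simp: square_verts_def intro: dist_verts_ge)
    show "ball v (?s / 2) \<subseteq> ?O - ?I" if v: "v \<in> ?D" for v
    proof
      fix z assume "z \<in> ball v (?s / 2)"
      then have "dist z v \<le> ?s / 2"
        by (simp add: dist_commute)
      note near = dist_le_imp_coords[OF this] dist_le_imp_coords[OF eq_refl[OF dist_partner[of v c w]]]
      have "partner c w v \<in> verts (hex_grid c w)"
        using v by (intro partner_verts) (simp add: square_verts_def)
      then have "partner c w v \<notin> cbox p (p + Complex n n)"
        using v by (auto simp: square_verts_def)
      then show "z \<in> ?O - ?I"
        using v near norm_ge_zero[of w] by (auto simp: square_verts_def in_cbox_complex_iff in_box_complex_iff)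
    qed
  qed
  also have "measure lborel (?O - ?I) = measure lborel ?O - measure lborel ?I"
  proof (rule measurable_measure_Diff)
    show "?O \<in> fmeasurable lborel"
      by (rule fmeasurable_cbox)
    show "?I \<subseteq> ?O"
      using s by (auto simp: in_cbox_complex_iff in_box_complex_iff simp del: zero_less_norm_iff)
  qed auto
  also have "\<dots> = ?a\<^sup>2 - ?b\<^sup>2"
    using assms(2) s by (simp add: area_cbox_square area_box_square)
  also have "\<dots> = 12 * ?s * real n - 12 * ?s\<^sup>2"
    by (simp add: power2_eq_square algebra_simps)
  also have "\<dots> \<le> 12 * ?s * real n"
    by simp
  finally show ?thesis
    by (simp add: power_divide)
qed

section \<open>The density\<close>

text \<open>
  The partner of a vertex of \<open>S\<close> is not in \<open>S\<close>.  Hence, up to the vertices whose partner lies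
  outside the square, \<open>S\<close> contains at most half of the vertices of the square.
\<close>

lemma card_independent_le:
  fixes p :: complex and n :: nat
  assumes "w \<noteq> 0" and S: "odd_independent_set (hex_grid c w) S"
  defines "Q \<equiv> square_verts (hex_grid c w) p n"
  shows "2 * card (S \<inter> Q) \<le> card Q + card {v \<in> Q. partner c w v \<notin> Q}"
proof -
  let ?D = "{v \<in> Q. partner c w v \<notin> Q}"
  have fin: "finite Q"
    unfolding Q_def by (rule finite_square_verts[OF assms(1)])
  have Q: "Q \<subseteq> verts (hex_grid c w)"
    by (simp add: Q_def square_verts_def)
  have "inj_on (partner c w) (S \<inter> Q - ?D)"
    by (rule inj_on_inverseI[of _ "partner c w"]) (use Q partner_partner[OF assms(1)] in blast)
  moreover have "partner c w ` (S \<inter> Q - ?D) \<subseteq> Q - S"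
  proof
    fix u assume "u \<in> partner c w ` (S \<inter> Q - ?D)"
    then obtain v where v: "u = partner c w v" "v \<in> S" "v \<in> Q" "u \<in> Q"
      by blast
    have "{v, u} \<in> edges (hex_grid c w)"
      unfolding v(1) using partner_edge[OF assms(1)] v(3) Q by blast
    then show "u \<in> Q - S"
      using S v unfolding odd_independent_set_def by blast
  qed
  ultimately have "card (S \<inter> Q - ?D) \<le> card (Q - S)"
    using fin by (intro card_inj_on_le) auto
  moreover have "card (S \<inter> Q) \<le> card (S \<inter> Q - ?D) + card ?D"
    using diff_card_le_card_Diff[of ?D "S \<inter> Q"] fin by simp
  moreover have "card (Q - S) + card (S \<inter> Q) = card Q"
    using fin card_Int_Diff[of Q S] by (simp add: Int_commute)
  ultimately show ?thesis
    by linarith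
qed

lemma limsup_density_le:
  assumes "w \<noteq> 0" and S: "odd_independent_set (hex_grid c w) S"
  shows "limsup (\<lambda>n. SUP p. ereal (real (card (S \<inter> square_verts (hex_grid c w) p n)) /
           real (card (square_verts (hex_grid c w) p n)))) \<le> ereal (1 / 2)" (is "limsup ?d \<le> _")
proof -
  let ?s = "norm w"
  \<comment> \<open>With \<open>s = norm w\<close>, the second term bounds half of the quotient of the two area bounds,
    at most \<open>48 s n / (pi s\<^sup>2)\<close> boundary vertices among at least \<open>(n - 6 s)\<^sup>2 / (9 pi s\<^sup>2)\<close>, once
    \<open>n - 6 s \<ge> n / 2\<close>.\<close>
  define g where "g n = 1 / 2 + 864 * ?s / real n" for n
  have s: "?s > 0"
    using assms(1) by simp
  have bound: "?d n \<le> ereal (g n)" if n: "real n > 12 * ?s" for n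
  proof (rule SUP_least)
    fix p
    define Q where "Q = square_verts (hex_grid c w) p n"
    define D where "D = {v \<in> Q. partner c w v \<notin> Q}"
    let ?k = "real (card Q)"
    have D: "real (card D) * (pi * ?s\<^sup>2) \<le> 48 * ?s * real n"
      unfolding D_def Q_def using n s by (intro card_boundary_le[OF assms(1)]) linarith
    have Q: "(real n - 6 * ?s)\<^sup>2 \<le> ?k * (9 * pi * ?s\<^sup>2)"
      unfolding Q_def using n by (intro card_square_verts_ge[OF assms(1)]) linarith
    have n0: "real n > 0"
      using n s by linarith
    have half: "real n / 2 \<le> real n - 6 * ?s"
      using n by linarith
    then have "(real n - 6 * ?s)\<^sup>2 > 0"
      using n0 by simp
    then have k: "?k > 0"
      using Q by (cases "card Q = 0") auto
    have "(real (card D) * (pi * ?s\<^sup>2)) * (real n - 6 * ?s)\<^sup>2 \<le> (48 * ?s * real n) * (?k * (9 * pi * ?s\<^sup>2))"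
      using D Q by (rule mult_mono) simp_all
    then have "(pi * ?s\<^sup>2) * (real (card D) * (real n - 6 * ?s)\<^sup>2) \<le> (pi * ?s\<^sup>2) * (432 * ?s * real n * ?k)"
      by (simp add: mult_ac)
    then have "real (card D) * (real n - 6 * ?s)\<^sup>2 \<le> 432 * ?s * real n * ?k"
      by (rule mult_left_le_imp_le) (use s in simp)
    moreover have "real (card D) * (real n / 2)\<^sup>2 \<le> real (card D) * (real n - 6 * ?s)\<^sup>2"
      using half n0 by (intro mult_left_mono power_mono) simp_all
    ultimately have "real n * (real (card D) * real n) \<le> real n * (1728 * ?s * ?k)"
      by (simp add: power2_eq_square mult_ac)
    then have "real (card D) * real n \<le> 1728 * ?s * ?k"
      by (rule mult_left_le_imp_le) (use n0 in simp)
    then have "real (card D) / ?k \<le> 1728 * ?s / real n"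
      using n0 k by (simp add: field_simps)
    moreover have "2 * real (card (S \<inter> Q)) \<le> ?k + real (card D)"
      using card_independent_le[OF assms, of p n] unfolding D_def Q_def by linarith
    then have "2 * (real (card (S \<inter> Q)) / ?k) \<le> 1 + real (card D) / ?k"
      using k by (simp add: field_simps)
    ultimately have "real (card (S \<inter> Q)) / ?k \<le> g n"
      unfolding g_def by simp
    then show "ereal (real (card (S \<inter> square_verts (hex_grid c w) p n)) /
        real (card (square_verts (hex_grid c w) p n))) \<le> ereal (g n)"
      by (simp add: Q_def)
  qed
  have "eventually (\<lambda>n. real n > 12 * ?s) sequentially"
    using filterlim_real_sequentially by (simp add: filterlim_at_top_dense)
  then have "limsup ?d \<le> limsup (\<lambda>n. ereal (g n))"
    by (intro Limsup_mono) (auto elim: eventually_mono simp: bound)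
  also have "g \<longlonglongrightarrow> 1 / 2"
    unfolding g_def using tendsto_add[OF tendsto_const lim_const_over_n] by fastforce
  then have "limsup (\<lambda>n. ereal (g n)) = ereal (1 / 2)"
    by (intro lim_imp_Limsup) auto
  finally show ?thesis .
qed

text \<open>
  The point reflection in the center \<open>c\<close> of a tile exchanges the two classes and maps axis-parallel
  squares to axis-parallel squares.
\<close>

lemma reflect_class:
  assumes "r \<in> {1, 2}"
  shows "2 * c - v \<in> hex_class c w r \<longleftrightarrow> v \<in> hex_class c w (3 - r)"
proof -
  have *: "2 * c - u \<in> hex_class c w (3 - q)" if q: "q \<in> {1, 2}" and u: "u \<in> hex_class c w q" for u q
  proof -
    from u obtain x y where xy: "u = hex_point c w x y" "(x - y) mod 3 = q"
      by (auto simp: hex_class_def)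
    have "2 * c - u = hex_point c w (- x) (- y)"
      by (simp add: xy hex_point_def algebra_simps)
    moreover have "(- x - - y) mod 3 = 3 - q"
      using zmod_zminus1_eq_if[of "x - y" 3] xy(2) q by auto
    ultimately show ?thesis
      unfolding hex_class_def by blast
  qed
  show ?thesis
    using *[of "3 - r" v] *[of r "2 * c - v"] assms by auto
qed

lemma reflect_square_verts:
  "2 * c - v \<in> square_verts (hex_grid c w) p n \<longleftrightarrow>
   v \<in> square_verts (hex_grid c w) (2 * c - p - Complex n n) n"
proof -
  have "2 * c - v \<in> cbox p (p + Complex n n) \<longleftrightarrow>
      v \<in> cbox (2 * c - p - Complex n n) (2 * c - p - Complex n n + Complex n n)"
    by (auto simp: in_cbox_complex_iff)
  then show ?thesis
    using reflect_class[of 1 c v w] reflect_class[of 2 c v w]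
    by (auto simp: square_verts_def verts_hex_grid)
qed

lemma card_reflect:
  fixes A B :: "complex set"
  assumes "\<And>v. 2 * c - v \<in> A \<longleftrightarrow> v \<in> B"
  shows "card A = card B"
proof (rule bij_betw_same_card)
  show "bij_betw (\<lambda>v. 2 * c - v) A B"
  proof (rule bij_betw_byWitness[where f' = "\<lambda>v. 2 * c - v"])
    show "(\<lambda>v. 2 * c - v) ` A \<subseteq> B"
    proof
      fix u assume "u \<in> (\<lambda>v. 2 * c - v) ` A"
      then have "2 * c - u \<in> A"
        by auto
      then show "u \<in> B"
        using assms by blast
    qed
    show "(\<lambda>v. 2 * c - v) ` B \<subseteq> A"
      using assms by blast
  qed simp_all
qed

text \<open>
  For every \<open>n\<close>, one of two squares that are exchanged by the reflection has at least half of its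
  vertices in class 1, since class 1 has the same share in one of them as class 2 has in the other.
\<close>

lemma density_hex_class_ge:
  assumes "w \<noteq> 0"
  shows "ereal (1 / 2) \<le> (SUP p. ereal (real (card (hex_class c w 1 \<inter> square_verts (hex_grid c w) p n)) /
           real (card (square_verts (hex_grid c w) p n))))" (is "_ \<le> (SUP p. ereal (?d p))")
proof -
  \<comment> \<open>The lower left corner \<open>p\<close> is a vertex, so the square contains one even for \<open>n = 0\<close> and no share is \<open>0 / 0\<close>.\<close>
  define p where "p = hex_point c w 1 0"
  define p' where "p' = 2 * c - p - Complex n n"
  let ?Q = "square_verts (hex_grid c w)"
  have fin: "finite (?Q p n)"
    by (rule finite_square_verts[OF assms])
  have "p \<in> ?Q p n"
    by (simp add: square_verts_def verts_hex_grid p_def hex_point_mem_class_iff assms in_cbox_complex_iff)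
  then have pos: "card (?Q p n) > 0"
    using fin by (auto simp: card_gt_0_iff)
  have "?Q p n = (hex_class c w 1 \<inter> ?Q p n) \<union> (hex_class c w 2 \<inter> ?Q p n)"
    by (auto simp: square_verts_def verts_hex_grid)
  then have "card (?Q p n) = card (hex_class c w 1 \<inter> ?Q p n) + card (hex_class c w 2 \<inter> ?Q p n)"
    using fin hex_class_disjoint[OF assms, of c] by (subst card_Un_disjoint[symmetric]) auto
  moreover have "card (hex_class c w 2 \<inter> ?Q p n) = card (hex_class c w 1 \<inter> ?Q p' n)"
    by (rule card_reflect[of c]) (simp add: p'_def reflect_class reflect_square_verts)
  moreover have "card (?Q p n) = card (?Q p' n)"
    by (rule card_reflect[of c]) (simp add: p'_def reflect_square_verts)
  ultimately have "?d p + ?d p' = 1"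
    using pos by (simp add: add_divide_distrib[symmetric] flip: of_nat_add)
  then have "1 / 2 \<le> ?d p \<or> 1 / 2 \<le> ?d p'"
    by linarith
  then show ?thesis
    by (auto intro: SUP_upper2)
qed

lemma density_hex_grid:
  assumes "w \<noteq> 0"
  shows "odd_independence_density (hex_grid c w) = ereal (1 / 2)"
  unfolding odd_independence_density_def
proof (rule antisym)
  show "(SUP S \<in> {S. odd_independent_set (hex_grid c w) S}.
      limsup (\<lambda>n. SUP p. ereal (real (card (S \<inter> square_verts (hex_grid c w) p n)) /
                                real (card (square_verts (hex_grid c w) p n))))) \<le> ereal (1 / 2)"
    using limsup_density_le[OF assms] by (intro SUP_least) auto
next
  have "ereal (1 / 2) \<le> limsup (\<lambda>n. SUP p. ereal (real (card (hex_class c w 1 \<inter> square_verts (hex_grid c w) p n)) /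
           real (card (square_verts (hex_grid c w) p n))))"
    using density_hex_class_ge[OF assms] by (intro le_Limsup) auto
  also have "\<dots> \<le> (SUP S \<in> {S. odd_independent_set (hex_grid c w) S}.
      limsup (\<lambda>n. SUP p. ereal (real (card (S \<inter> square_verts (hex_grid c w) p n)) /
                                real (card (square_verts (hex_grid c w) p n)))))"
    using odd_independent_hex_class[OF assms] by (intro SUP_upper) auto
  finally show "ereal (1 / 2) \<le> (SUP S \<in> {S. odd_independent_set (hex_grid c w) S}.
      limsup (\<lambda>n. SUP p. ereal (real (card (S \<inter> square_verts (hex_grid c w) p n)) /
                                real (card (square_verts (hex_grid c w) p n)))))" .
qed

theorem proposition26:
  fixes c w :: complex
  assumes "w \<noteq> 0"
  shows "odd_independence_density (hex_grid c w) = 1 / 2 \<and>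
         strong_odd_chromatic_number (hex_grid c w) = 2"
  using density_hex_grid[OF assms] strong_odd_chromatic_number_hex_grid[OF assms]
  by (simp add: one_ereal_def numeral_eq_ereal)

end
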